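(* Let $K$ be a field of characteristic $0$, let $n\ge 1$, and let $\mathbf{q}=(q_1,\dots,q_n)$ be formal variables subject only to $q_1q_2\cdots q_n=1$. Then the element \[ \mathbf{e}_n(\mathbf{q})=\sum_{\sigma\in S_n}\frac{\prod_{j\in D(\sigma)} q_{\sigma(1)}q_{\sigma(2)}\cdots q_{\sigma(j)}}{\prod_{i=1}^{n-1}\bigl(1-q_{\sigma(1)}q_{\sigma(2)}\cdots q_{\sigma(i)}\bigr)}\,\sigma \] of $K(\mathbf{q})S_n$ is a Lie element.
   Context: $K(\mathbf{q})$ denotes the field of rational functions over $K$ in $q_1,\dots,q_{n-1}$, with $q_n:=(q_1\cdots q_{n-1})^{-1}$; in particular no product $q_{i_1}\cdots q_{i_r}$ over a nonempty proper subset $\{i_1,\dots,i_r\}\subsetneq\{1,\dots,n\}$ equals $1$. For a permutation $\sigma\in S_n$ written as the word $\sigma(1)\sigma(2)\cdots\sigma(n)$, its descent set is $D(\sigma)=\{i: 1\le i\le n-1,\ \sigma(i)>\sigma(i+1)\}$. $K(\mathbf{q})S_n$ is the vector space of $K(\mathbf{q})$-linear combinations of permutations of $S_n$, each permutation viewed as a word on the alphabet $X=\{1,\dots,n\}$, so that $K(\mathbf{q})S_n$ sits inside the free associative algebra $K(\mathbf{q})\langle X\rangle$ (product = concatenation of words). The Lie bracket is $[p,q]=pq-qp$, and the free Lie algebra $\mathcal{L}_{K(\mathbf{q})}(X)$ is the smallest subspace of $K(\mathbf{q})\langle X\rangle$ containing $X$ and closed under the bracket. A Lie element is an element of $K(\mathbf{q})S_n\cap\mathcal{L}_{K(\mathbf{q})}(X)$.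 *)

theory Defs
  imports
    "HOL-Library.Poly_Mapping"
    "HOL-Computational_Algebra.Fraction_Field"
    "HOL-Combinatorics.Permutations"
begin

section \<open>Rational functions in several variables\<close>

text \<open>
  Polynomials over \<open>'k\<close> are finitely supported functions on the exponent vectors
  \<open>nat \<Rightarrow>\<^sub>0 nat\<close>.  The type provides infinitely many indeterminates; the field
  \<open>K(x_v | v \<in> V)\<close> is the subfield of those fractions that can be written with
  indeterminates from \<open>V\<close> only.
\<close>

type_synonym 'k mpoly = "(nat \<Rightarrow>\<^sub>0 nat) \<Rightarrow>\<^sub>0 'k"

type_synonym 'k ratfun = "'k mpoly fract"

definition poly_vars :: "'k::zero mpoly \<Rightarrow> nat set" where
  "poly_vars p = (\<Union>m\<in>Poly_Mapping.keys p. Poly_Mapping.keys m)"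

definition indet :: "nat \<Rightarrow> 'k::field ratfun" where
  "indet i = Fract (Poly_Mapping.single (Poly_Mapping.single i 1) 1) 1"

definition rational_functions :: "nat set \<Rightarrow> 'k::field ratfun set" where
  "rational_functions V =
     {Fract a b | a b. b \<noteq> 0 \<and> poly_vars a \<subseteq> V \<and> poly_vars b \<subseteq> V}"

text \<open>
  \<open>Kq n\<close> is the field \<open>K(q_1, \<dots>, q_(n-1))\<close>, and \<open>qvar n i\<close> is its element \<open>q_i\<close>
  for \<open>1 \<le> i \<le> n\<close>.
\<close>

definition Kq :: "nat \<Rightarrow> 'k::field ratfun set" where
  "Kq n = rational_functions {1..<n}"

definition qvar :: "nat \<Rightarrow> nat \<Rightarrow> 'k::field ratfun" where
  "qvar n i = (if i = n then inverse (\<Prod>j\<in>{1..<n}. indet j) else indet i)"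

lemma indet_nonzero: "indet i \<noteq> (0 :: 'k::field ratfun)"
proof -
  have "Poly_Mapping.single (Poly_Mapping.single i (1::nat)) (1::'k) \<noteq> 0"
    by (metis lookup_single_eq lookup_zero zero_neq_one)
  then show ?thesis
    by (simp add: indet_def Zero_fract_def eq_fract)
qed

lemma prod_qvar:
  assumes "n \<ge> 1"
  shows "(\<Prod>i=1..n. qvar n i) = (1 :: 'k::field ratfun)"
proof -
  have *: "{1..n} = insert n {1..<n}" using assms by auto
  have "(\<Prod>i\<in>{1..<n}. qvar n i) = (\<Prod>i\<in>{1..<n}. indet i :: 'k ratfun)"
    by (rule prod.cong) (auto simp: qvar_def)
  moreover have "(\<Prod>i\<in>{1..<n}. indet i :: 'k ratfun) \<noteq> 0"
    by (simp add: indet_nonzero)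
  moreover have "(\<Prod>i=1..n. qvar n i) = qvar n n * (\<Prod>i\<in>{1..<n}. qvar n i :: 'k ratfun)"
    unfolding * by (rule prod.insert) auto
  ultimately show ?thesis
    unfolding qvar_def[of n n] by (simp only: if_True left_inverse simp_thms)
qed

section \<open>The free associative algebra and the free Lie algebra\<close>

text \<open>
  Words form a monoid under concatenation, written additively because the convolution
  product on \<open>\<Rightarrow>\<^sub>0\<close> is indexed by an additive monoid.  With this instance
  \<open>'x word \<Rightarrow>\<^sub>0 'f\<close> is the free associative algebra over \<open>'f\<close> on \<open>'x\<close>, and \<open>*\<close> is the
  bilinear extension of concatenation.
\<close>

datatype 'x word = Word (letters: "'x list")

instantiation word :: (type) monoid_add
begin

definition zero_word :: "'a word" where
  "0 = Word []"

definition plus_word :: "'a word \<Rightarrow> 'a word \<Rightarrow> 'a word" where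
  "u + v = Word (letters u @ letters v)"

instance
  by standard (simp_all add: zero_word_def plus_word_def)

end

lemma times_single_word:
  "Poly_Mapping.single (Word u) a * Poly_Mapping.single (Word v) b =
     Poly_Mapping.single (Word (u @ v)) (a * b :: 'f::field)"
  by (simp add: mult_single plus_word_def)

definition scale :: "'f \<Rightarrow> ('x word \<Rightarrow>\<^sub>0 'f::field) \<Rightarrow> ('x word \<Rightarrow>\<^sub>0 'f)" where
  "scale c p = Poly_Mapping.map ((*) c) p"

lemma lookup_scale: "Poly_Mapping.lookup (scale c p) w = c * Poly_Mapping.lookup p w"
  by (simp add: scale_def Poly_Mapping.map.rep_eq when_def)

definition lie_bracket ::
  "('x word \<Rightarrow>\<^sub>0 'f::field) \<Rightarrow> ('x word \<Rightarrow>\<^sub>0 'f) \<Rightarrow> ('x word \<Rightarrow>\<^sub>0 'f)" where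
  "lie_bracket p q = p * q - q * p"

text \<open>
  For a subfield \<open>F\<close> of \<open>'f\<close>: the smallest \<open>F\<close>-subspace that contains the letters in
  \<open>X\<close> and is closed under the bracket.
\<close>

inductive_set free_lie :: "'f::field set \<Rightarrow> 'x set \<Rightarrow> ('x word \<Rightarrow>\<^sub>0 'f) set"
  for F :: "'f set" and X :: "'x set" where
  letter: "x \<in> X \<Longrightarrow> Poly_Mapping.single (Word [x]) 1 \<in> free_lie F X"
| zero: "0 \<in> free_lie F X"
| add: "p \<in> free_lie F X \<Longrightarrow> q \<in> free_lie F X \<Longrightarrow> p + q \<in> free_lie F X"
| scale: "c \<in> F \<Longrightarrow> p \<in> free_lie F X \<Longrightarrow> scale c p \<in> free_lie F X"
| bracket: "p \<in> free_lie F X \<Longrightarrow> q \<in> free_lie F X \<Longrightarrow> lie_bracket p q \<in> free_lie F X"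

section \<open>Permutations as words\<close>

definition perm_word :: "nat \<Rightarrow> (nat \<Rightarrow> nat) \<Rightarrow> nat word" where
  "perm_word n \<sigma> = Word (map \<sigma> [1..<Suc n])"

definition descents :: "nat \<Rightarrow> (nat \<Rightarrow> nat) \<Rightarrow> nat set" where
  "descents n \<sigma> = {i. 1 \<le> i \<and> i \<le> n - 1 \<and> \<sigma> i > \<sigma> (i + 1)}"

definition perm_space :: "'f::field set \<Rightarrow> nat \<Rightarrow> (nat word \<Rightarrow>\<^sub>0 'f) set" where
  "perm_space F n =
     {(\<Sum>\<sigma> | \<sigma> permutes {1..n}. scale (c \<sigma>) (Poly_Mapping.single (perm_word n \<sigma>) 1)) | c.
        \<forall>\<sigma>. \<sigma> permutes {1..n} \<longrightarrow> c \<sigma> \<in> F}"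

definition lie_elements :: "'f::field set \<Rightarrow> nat \<Rightarrow> (nat word \<Rightarrow>\<^sub>0 'f) set" where
  "lie_elements F n = perm_space F n \<inter> free_lie F {1..n}"

definition e_coeff :: "nat \<Rightarrow> (nat \<Rightarrow> nat) \<Rightarrow> 'k::field ratfun" where
  "e_coeff n \<sigma> =
     (\<Prod>j\<in>descents n \<sigma>. \<Prod>k=1..j. qvar n (\<sigma> k)) /
     (\<Prod>i=1..n - 1. 1 - (\<Prod>k=1..i. qvar n (\<sigma> k)))"

definition e_elem :: "nat \<Rightarrow> (nat word \<Rightarrow>\<^sub>0 'k::field ratfun)" where
  "e_elem n =
     (\<Sum>\<sigma> | \<sigma> permutes {1..n}.
        scale (e_coeff n \<sigma>) (Poly_Mapping.single (perm_word n \<sigma>) 1))"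

end

(*
  The coefficient of a word is, up to one missing factor, the generating function of the P-partitions
  of a chain, and these functions are multiplicative: summed over all shuffles of two words they give
  the product of the two functions.  The relation q_1 ... q_n = 1 turns this into the vanishing of the
  sum of the coefficients over the shuffles of two nonempty words u and v with disjoint letters.
  Splitting the shuffles by their first letter gives, for a fixed letter x,
    coefficient of (rev p) x v = (-1)^|p| * (sum of the coefficients of x w over the shuffles w of p and v),
  and the right-hand side is the coefficient of (rev p) x v in the sum over all w of the left-normed
  brackets [...[[x, w_1], w_2], ...], each weighted by the coefficient of x w.
*)

theory Submission
  imports "HOL-Combinatorics.Multiset_Permutations" Defs
begin

section \<open>Chain weights and their sums over shuffles\<close>

text \<open>
  The generating function of the P-partitions of a chain, up to sign, with an extra letter \<open>t\<close> in front.
  As all letters together have product \<open>1\<close>, a prefix product is the inverse of the complementary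
  suffix product \<open>S\<close>; with \<open>Q = 1 / S\<close> one has \<open>Q / (1 - Q) = 1 / (S - 1)\<close> and
  \<open>1 / (1 - Q) = S / (S - 1)\<close>, so the descents of the prefix formula become ascents here.
\<close>

fun chain_weight :: "('a::linorder \<Rightarrow> 'f::field) \<Rightarrow> 'a \<Rightarrow> 'a list \<Rightarrow> 'f" where
  "chain_weight q t [] = 1"
| "chain_weight q t (a # r) =
     (if t < a then prod q (set (a # r)) else 1) / (prod q (set (a # r)) - 1) * chain_weight q a r"

lemma sum_shuffles_Cons:
  assumes "a \<noteq> b"
  shows "(\<Sum>w\<in>shuffles (a # u) (b # v). f w) =
    (\<Sum>w\<in>shuffles u (b # v). f (a # w)) + (\<Sum>w\<in>shuffles (a # u) v. f (b # w))"
proof -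
  have "(\<Sum>w\<in>shuffles (a # u) (b # v). f w) =
      sum f ((#) a ` shuffles u (b # v)) + sum f ((#) b ` shuffles (a # u) v)"
    unfolding shuffles.simps using assms by (intro sum.union_disjoint) auto
  then show ?thesis
    by (simp add: sum.reindex)
qed

text \<open>Two-letter core of multiplicativity. Expanded formally as geometric series, both sides
  are the sum of x^i y^j over i, j >= 0, with i >= 1 if \<open>t < a\<close> and j >= 1 if
  \<open>t < b\<close>. The left side splits these pairs by the smaller exponent, a tie going to the
  term of the larger letter.\<close>

lemma chain_weight_shuffle_identity:
  fixes x y :: "'f::field" and a b t :: "'a::linorder"
  assumes "x \<noteq> 1" "y \<noteq> 1" "x * y \<noteq> 1" "a \<noteq> b"
  shows "(if t < a then x * y else 1) / (x * y - 1) * ((if a < b then y else 1) / (y - 1)) +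
      (if t < b then x * y else 1) / (x * y - 1) * ((if b < a then x else 1) / (x - 1)) =
    (if t < a then x else 1) / (x - 1) * ((if t < b then y else 1) / (y - 1))"
proof -
  have nz: "x - 1 \<noteq> 0" "y - 1 \<noteq> 0" "x * y - 1 \<noteq> 0"
    using assms by auto
  have clear_denoms: "(A / (x * y - 1)) * (B / (y - 1)) + (C / (x * y - 1)) * (D / (x - 1)) = E / (x - 1) * (G / (y - 1))"
    if "A * B * (x - 1) + C * D * (y - 1) = E * G * (x * y - 1)" for A B C D E G
  proof -
    have clear_denoms: "(A / (x * y - 1)) * (B / (y - 1)) + (C / (x * y - 1)) * (D / (x - 1)) =
      (A * B * (x - 1) + C * D * (y - 1)) / ((x * y - 1) * (x - 1) * (y - 1))"
      using nz by (simp add: divide_simps del: right_minus_eq)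
    also have "\<dots> = E / (x - 1) * (G / (y - 1))"
      unfolding that using nz by (simp add: divide_simps del: right_minus_eq)
    finally show ?thesis .
  qed
  \<comment> \<open>With the denominators cleared, each possible order of \<open>t\<close>,
    \<open>a\<close>, \<open>b\<close> leaves a polynomial identity.\<close>
  show ?thesis
    by (rule clear_denoms) (use \<open>a \<noteq> b\<close> in \<open>auto simp: algebra_simps\<close>)
qed

text \<open>Induction along the shuffle recursion, splitting by the first letter. That letter
  becomes the front letter of the rest, so \<open>t\<close> has to vary.\<close>

lemma sum_shuffles_chain_weight:
  assumes "distinct (u @ v)"
    and "\<And>A. A \<subseteq> set (u @ v) \<Longrightarrow> A \<noteq> {} \<Longrightarrow> prod q A \<noteq> 1"
  shows "(\<Sum>w\<in>shuffles u v. chain_weight q t w) = chain_weight q t u * chain_weight q t v"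
  using assms
proof (induction u v arbitrary: t rule: shuffles.induct)
  case (3 a u b v)
  define x y where "x = prod q (set (a # u))" and "y = prod q (set (b # v))"
  have xy: "prod q (set (a # u) \<union> set (b # v)) = x * y"
    unfolding x_def y_def using "3.prems"(1) by (intro prod.union_disjoint) auto
  have "x \<noteq> 1" "y \<noteq> 1" "x * y \<noteq> 1"
    unfolding xy[symmetric] unfolding x_def y_def by (rule "3.prems"(2); force)+
  moreover have "a \<noteq> b"
    using "3.prems"(1) by auto
  ultimately have nt: "x \<noteq> 1" "y \<noteq> 1" "x * y \<noteq> 1" "a \<noteq> b" .
  \<comment> \<open>Both induction hypotheses are unfolded by one letter to expose the common factor
    \<open>chain_weight q a u * chain_weight q b v\<close>; only the two-letter identity then
    remains.\<close>
  have IH1: "(\<Sum>w\<in>shuffles u (b # v). chain_weight q a w) =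
      chain_weight q a u * ((if a < b then y else 1) / (y - 1) * chain_weight q b v)"
    using "3.IH"(1)[of a] "3.prems" by (simp add: y_def subset_insertI2)
  have IH2: "(\<Sum>w\<in>shuffles (a # u) v. chain_weight q b w) =
      (if b < a then x else 1) / (x - 1) * chain_weight q a u * chain_weight q b v"
  proof -
    have "(\<Sum>w\<in>shuffles (a # u) v. chain_weight q b w) = chain_weight q b (a # u) * chain_weight q b v"
    proof (rule "3.IH"(2))
      show "distinct ((a # u) @ v)" using "3.prems"(1) by auto
      show "prod q A \<noteq> 1" if "A \<subseteq> set ((a # u) @ v)" "A \<noteq> {}" for A
        using that by (intro "3.prems"(2)) auto
    qed
    then show ?thesis by (simp add: x_def)
  qed
  \<comment> \<open>All shuffles have the same letters, so the leading factor is constant and leaves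
    the sum.\<close>
  have prod_a: "prod q (set (a # w)) = x * y" if "w \<in> shuffles u (b # v)" for w
  proof -
    have "set (a # w) = set (a # u) \<union> set (b # v)"
      using set_shuffles[OF that] by auto
    then show ?thesis using xy by (simp only:)
  qed
  have prod_b: "prod q (set (b # w)) = x * y" if "w \<in> shuffles (a # u) v" for w
  proof -
    have "set (b # w) = set (a # u) \<union> set (b # v)"
      using set_shuffles[OF that] by auto
    then show ?thesis using xy by (simp only:)
  qed
  have "(\<Sum>w\<in>shuffles u (b # v). chain_weight q t (a # w)) =
      (if t < a then x * y else 1) / (x * y - 1) * (\<Sum>w\<in>shuffles u (b # v). chain_weight q a w)"
    unfolding sum_distrib_left by (intro sum.cong refl) (simp only: chain_weight.simps prod_a)
  moreover have "(\<Sum>w\<in>shuffles (a # u) v. chain_weight q t (b # w)) =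
      (if t < b then x * y else 1) / (x * y - 1) * (\<Sum>w\<in>shuffles (a # u) v. chain_weight q b w)"
    unfolding sum_distrib_left by (intro sum.cong refl) (simp only: chain_weight.simps prod_b)
  ultimately have "(\<Sum>w\<in>shuffles (a # u) (b # v). chain_weight q t w) =
      ((if t < a then x * y else 1) / (x * y - 1) * ((if a < b then y else 1) / (y - 1)) +
       (if t < b then x * y else 1) / (x * y - 1) * ((if b < a then x else 1) / (x - 1))) *
      (chain_weight q a u * chain_weight q b v)"
    unfolding sum_shuffles_Cons[OF \<open>a \<noteq> b\<close>]
    by (simp only: IH1 IH2 distrib_left distrib_right mult_ac)
  then show ?case
    unfolding chain_weight_shuffle_identity[OF nt]
    by (simp add: x_def y_def mult_ac)
qed auto

text \<open>This is the vanishing of the sum of the coefficients over the shuffles of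
  \<open>a # p\<close> and \<open>b # s\<close>, split by first letter. Both sides factor by
  multiplicativity into a common part and one leading factor each; these two are opposite because x
  y = 1.\<close>

lemma sum_shuffles_chain_weight_transfer:
  assumes "distinct ((a # p) @ b # s)"
    and one: "prod q (set ((a # p) @ b # s)) = 1"
    and nontriv: "\<And>A. A \<subset> set ((a # p) @ b # s) \<Longrightarrow> A \<noteq> {} \<Longrightarrow> prod q A \<noteq> 1"
  shows "(\<Sum>w\<in>shuffles p (b # s). chain_weight q a w) = - (\<Sum>w\<in>shuffles (a # p) s. chain_weight q b w)"
proof -
  define x y where "x = prod q (set (a # p))" and "y = prod q (set (b # s))"
  have "prod q (set (a # p) \<union> set (b # s)) = x * y"
    unfolding x_def y_def using assms(1) by (intro prod.union_disjoint) auto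
  then have xy: "x * y = 1"
    using one by (simp only: set_append)
  have "x \<noteq> 1" "y \<noteq> 1"
    unfolding x_def y_def by (rule nontriv; use assms(1) in auto)+
  moreover have "a \<noteq> b"
    using assms(1) by auto
  ultimately have nt: "x \<noteq> 1" "y \<noteq> 1" "a \<noteq> b" .
  \<comment> \<open>The front letter \<open>a\<close> is not among the shuffled letters, so only
    proper subsets occur and multiplicativity applies although the total product is 1.\<close>
  have "(\<Sum>w\<in>shuffles p (b # s). chain_weight q a w) = chain_weight q a p * chain_weight q a (b # s)"
    using assms(1) by (intro sum_shuffles_chain_weight nontriv) auto
  moreover have "(\<Sum>w\<in>shuffles (a # p) s. chain_weight q b w) = chain_weight q b (a # p) * chain_weight q b s"
    using assms(1) by (intro sum_shuffles_chain_weight nontriv) auto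
  moreover have "(if a < b then y else 1) / (y - 1) = - ((if b < a then x else 1) / (x - 1))"
  proof -
    have nz: "x - 1 \<noteq> 0" "y - 1 \<noteq> 0"
      using nt by auto
    have clear_denoms: "B / (y - 1) = - (D / (x - 1))" if "B * (x - 1) + D * (y - 1) = 0" for B D
    proof -
      have "B / (y - 1) + D / (x - 1) = (B * (x - 1) + D * (y - 1)) / ((x - 1) * (y - 1))"
        using nz by (simp add: divide_simps del: right_minus_eq)
      then show ?thesis
        unfolding that by (simp add: eq_neg_iff_add_eq_0)
    qed
    show ?thesis
      by (rule clear_denoms) (use \<open>a \<noteq> b\<close> xy in \<open>auto simp: algebra_simps\<close>)
  qed
  moreover have "chain_weight q a (b # s) = (if a < b then y else 1) / (y - 1) * chain_weight q b s"
    "chain_weight q b (a # p) = (if b < a then x else 1) / (x - 1) * chain_weight q a p"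
    by (simp_all add: x_def y_def)
  ultimately show ?thesis
    by (simp only: mult_minus_left mult_minus_right mult_ac)
qed

text \<open>Taking the first letter as front letter omits the factor of the whole word, whose
  denominator would vanish when all letters have product 1. On the words of permutations this will
  be \<open>e_coeff\<close>.\<close>

definition cyclic_weight :: "('a::linorder \<Rightarrow> 'f::field) \<Rightarrow> 'a list \<Rightarrow> 'f" where
  "cyclic_weight q w = chain_weight q (hd w) (tl w)"

text \<open>Induction on \<open>p\<close>: read \<open>rev (a # p) @ x # v\<close> as
  \<open>rev p @ a # (x # v)\<close>, with \<open>a\<close> in the role of \<open>x\<close>; the
  transfer lemma then moves this role from \<open>a\<close> to \<open>x\<close> at the cost of one
  sign.\<close>

lemma cyclic_weight_rev_append:
  assumes "distinct (rev p @ x # v)"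
    and "prod q (set (rev p @ x # v)) = 1"
    and "\<And>A. A \<subset> set (rev p @ x # v) \<Longrightarrow> A \<noteq> {} \<Longrightarrow> prod q A \<noteq> 1"
  shows "cyclic_weight q (rev p @ x # v) = (-1) ^ length p * (\<Sum>w\<in>shuffles p v. chain_weight q x w)"
  using assms
proof (induction p arbitrary: x v)
  case Nil
  then show ?case by (simp add: cyclic_weight_def)
next
  case (Cons a p)
  have "cyclic_weight q (rev p @ a # x # v) =
      (-1) ^ length p * (\<Sum>w\<in>shuffles p (x # v). chain_weight q a w)"
    using Cons.prems by (intro Cons.IH) auto
  also have "(\<Sum>w\<in>shuffles p (x # v). chain_weight q a w) = - (\<Sum>w\<in>shuffles (a # p) v. chain_weight q x w)"
  proof (rule sum_shuffles_chain_weight_transfer)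
    have s: "set ((a # p) @ x # v) = set (rev (a # p) @ x # v)" by auto
    show "distinct ((a # p) @ x # v)" using Cons.prems(1) by auto
    show "prod q (set ((a # p) @ x # v)) = 1" using Cons.prems(2) unfolding s .
    show "prod q A \<noteq> 1" if "A \<subset> set ((a # p) @ x # v)" "A \<noteq> {}" for A
      using that unfolding s by (rule Cons.prems(3))
  qed
  finally show ?case by simp
qed

section \<open>Unshuffles and left-normed brackets\<close>

abbreviation monomial :: "'x list \<Rightarrow> 'x word \<Rightarrow>\<^sub>0 'f::field" where
  "monomial w \<equiv> Poly_Mapping.single (Word w) 1"

text \<open>Being a set, this forgets multiplicities, so it indexes the ways to split the positions
  of \<open>w\<close> faithfully only when the letters of \<open>w\<close> are distinct.\<close>

definition unshuffles :: "'x list \<Rightarrow> ('x list \<times> 'x list) set" where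
  "unshuffles w = {(p, v). w \<in> shuffles p v}"

lemma unshuffles_Nil: "unshuffles [] = {([], [])}"
  by (auto simp: unshuffles_def)

lemma unshuffles_Cons:
  "unshuffles (a # w) = (\<lambda>(p, v). (a # p, v)) ` unshuffles w \<union> (\<lambda>(p, v). (p, a # v)) ` unshuffles w"
  by (auto simp: unshuffles_def Cons_in_shuffles_iff image_iff neq_Nil_conv)

lemma finite_unshuffles: "finite (unshuffles w)"
  by (induction w) (simp_all add: unshuffles_Nil unshuffles_Cons)

lemma sum_unshuffles_Cons:
  assumes "a \<notin> set w"
  shows "(\<Sum>(p, v)\<in>unshuffles (a # w). f p v) =
    (\<Sum>(p, v)\<in>unshuffles w. f (a # p) v) + (\<Sum>(p, v)\<in>unshuffles w. f p (a # v))"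
proof -
  have "a \<notin> set p" if "(p, v) \<in> unshuffles w" for p v
    using that assms set_shuffles[of w p v] by (auto simp: unshuffles_def)
  then have "(\<lambda>(p, v). (a # p, v)) ` unshuffles w \<inter> (\<lambda>(p, v). (p, a # v)) ` unshuffles w = {}"
    by fastforce
  moreover have "inj_on (\<lambda>(p, v). (a # p, v)) (unshuffles w)" "inj_on (\<lambda>(p, v). (p, a # v)) (unshuffles w)"
    by (auto intro!: inj_onI)
  ultimately show ?thesis
    unfolding unshuffles_Cons
    by (simp add: sum.union_disjoint finite_unshuffles sum.reindex case_prod_unfold)
qed

text \<open>Bracketing with a letter puts it at the right end or, with a minus sign, at the left
  end. Letters sent right keep their order, those sent left end up reversed.\<close>

lemma foldl_lie_bracket:
  fixes z :: "'x word \<Rightarrow>\<^sub>0 'f::field"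
  assumes "distinct w"
  shows "foldl (\<lambda>z a. lie_bracket z (monomial [a])) z w =
    (\<Sum>(p, v)\<in>unshuffles w. (-1) ^ length p * (monomial (rev p) * z * monomial v))"
  using assms
proof (induction w arbitrary: z)
  case Nil
  then show ?case by (simp add: unshuffles_Nil flip: zero_word_def)
next
  case (Cons a w)
  have bracket: "(-1) ^ length p * (monomial (rev p) * lie_bracket z (monomial [a]) * monomial v) =
      (-1) ^ length (a # p) * (monomial (rev (a # p)) * z * monomial v) +
      (-1) ^ length p * (monomial (rev p) * z * monomial (a # v))" for p v
  proof -
    have "monomial (a # v) = monomial [a] * (monomial v :: 'x word \<Rightarrow>\<^sub>0 'f)"
      "monomial (rev (a # p)) = (monomial (rev p) :: 'x word \<Rightarrow>\<^sub>0 'f) * monomial [a]"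
      by (simp_all add: times_single_word)
    then show ?thesis
      by (simp add: lie_bracket_def algebra_simps)
  qed
  have "foldl (\<lambda>z a. lie_bracket z (monomial [a])) z (a # w) =
      (\<Sum>(p, v)\<in>unshuffles w. (-1) ^ length p * (monomial (rev p) * lie_bracket z (monomial [a]) * monomial v))"
    using Cons by simp
  also have "\<dots> = (\<Sum>(p, v)\<in>unshuffles (a # w). (-1) ^ length p * (monomial (rev p) * z * monomial v))"
    using Cons.prems
    by (subst sum_unshuffles_Cons) (simp_all only: bracket case_prod_unfold sum.distrib distinct.simps not_False_eq_True)
  finally show ?case .
qed

section \<open>The weighted sum of words as a combination of brackets\<close>

lemma scale_sum: "scale c (\<Sum>i\<in>I. f i) = (\<Sum>i\<in>I. scale c (f i))"
  by (rule poly_mapping_eqI) (simp add: lookup_scale lookup_sum sum_distrib_left)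

lemma sum_scale: "(\<Sum>i\<in>I. scale (c i) p) = scale (\<Sum>i\<in>I. c i) p"
  by (rule poly_mapping_eqI) (simp add: lookup_scale lookup_sum sum_distrib_right)

lemma scale_scale: "scale c (scale d p) = scale (c * d) p"
  by (rule poly_mapping_eqI) (simp add: lookup_scale)

text \<open>The power on the left is taken in the free algebra, the one on the right in the
  field.\<close>

lemma minus_one_power_times: "(-1) ^ k * p = scale ((-1) ^ k) p"
  by (rule poly_mapping_eqI, cases "even k") (auto simp: lookup_scale)

text \<open>Any fixed letter \<open>x\<close> works: it occurs once in each arrangement, which is
  thus uniquely \<open>rev p @ x # v\<close>. Its coefficient is a signed sum over shuffles of
  \<open>p\<close> and \<open>v\<close>, and exactly the brackets along these shuffles produce that
  word.\<close>

lemma cyclic_weight_sum_eq_foldl_lie_bracket: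
  fixes q :: "'a::linorder \<Rightarrow> 'f::field"
  assumes "finite X" "x \<in> X" and one: "prod q X = 1"
    and nontriv: "\<And>A. A \<subset> X \<Longrightarrow> A \<noteq> {} \<Longrightarrow> prod q A \<noteq> 1"
  shows "(\<Sum>w\<in>permutations_of_set X. scale (cyclic_weight q w) (monomial w)) =
    (\<Sum>w\<in>permutations_of_set (X - {x}).
      scale (chain_weight q x w) (foldl (\<lambda>z a. lie_bracket z (monomial [a])) (monomial [x]) w))"
proof -
  define P where "P = permutations_of_set (X - {x})"
  define D where "D = {(p, v). rev p @ x # v \<in> permutations_of_set X}"
  define g where "g = (\<lambda>(p, v). rev p @ x # v)"
  have "finite P"
    by (simp add: P_def)
  have bij: "bij_betw g D (permutations_of_set X)"
  proof (rule bij_betwI')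
    show "(g d = g d') = (d = d')" if "d \<in> D" "d' \<in> D" for d d'
    proof -
      obtain p v p' v' where [simp]: "d = (p, v)" "d' = (p', v')"
        by (metis surj_pair)
      have "x \<notin> set (rev p)" "x \<notin> set v" "x \<notin> set (rev p')" "x \<notin> set v'"
        using that by (auto simp: D_def permutations_of_set_def)
      then show ?thesis
        by (auto simp: g_def append_Cons_eq_iff)
    qed
    show "g d \<in> permutations_of_set X" if "d \<in> D" for d
      using that by (auto simp: g_def D_def)
    show "\<exists>d\<in>D. w = g d" if "w \<in> permutations_of_set X" for w
    proof -
      have "x \<in> set w"
        using that \<open>x \<in> X\<close> by (auto simp: permutations_of_set_def)
      then obtain u v where "w = u @ x # v"
        by (meson split_list)
      then have "(rev u, v) \<in> D" "w = g (rev u, v)"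
        using that by (auto simp: D_def g_def)
      then show ?thesis by blast
    qed
  qed
  then have "finite D"
    using bij_betw_finite by fastforce
  \<comment> \<open>A shuffle has the letters of \<open>p\<close> and \<open>v\<close> together, so
    either description of the pairs of a decomposition and a shuffle implies the other.\<close>
  have unsh: "(p, v) \<in> D \<and> w \<in> shuffles p v \<longleftrightarrow> w \<in> P \<and> (p, v) \<in> unshuffles w" for p v w
  proof (cases "w \<in> shuffles p v")
    case True
    then have "mset (rev p @ x # v) = mset (x # w)"
      by (simp add: mset_shuffles)
    then have "distinct (rev p @ x # v) \<longleftrightarrow> distinct (x # w)" "set (rev p @ x # v) = set (x # w)"
      by (metis mset_eq_imp_distinct_iff, metis mset_eq_setD)
    then show ?thesis
      using True \<open>x \<in> X\<close> unfolding D_def P_def permutations_of_set_def unshuffles_def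
      by auto
  qed (auto simp: unshuffles_def)
  have "(\<Sum>w\<in>permutations_of_set X. scale (cyclic_weight q w) (monomial w)) =
      (\<Sum>d\<in>D. scale (cyclic_weight q (g d)) (monomial (g d)))"
    by (rule sum.reindex_bij_betw[OF bij, symmetric])
  \<comment> \<open>The shuffles of \<open>p\<close> and \<open>v\<close> are recast as the members
    of \<open>P\<close> that unshuffle into them, so that the two sums can be exchanged.\<close>
  also have "\<dots> = (\<Sum>d\<in>D. \<Sum>w | w \<in> P \<and> d \<in> unshuffles w.
      scale (chain_weight q x w * (-1) ^ length (fst d)) (monomial (g d)))"
  proof (rule sum.cong[OF refl])
    fix d assume "d \<in> D"
    obtain p v where [simp]: "d = (p, v)"
      by (metis surj_pair)
    have pv: "distinct (rev p @ x # v)" "set (rev p @ x # v) = X"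
      using \<open>d \<in> D\<close> by (auto simp: D_def permutations_of_set_def)
    have "cyclic_weight q (rev p @ x # v) = (-1) ^ length p * (\<Sum>w\<in>shuffles p v. chain_weight q x w)"
      by (rule cyclic_weight_rev_append) (use pv(1) one nontriv in \<open>simp_all only: pv(2)\<close>)
    moreover have "{w. w \<in> P \<and> d \<in> unshuffles w} = shuffles p v"
      using unsh \<open>d \<in> D\<close> by auto
    ultimately show "scale (cyclic_weight q (g d)) (monomial (g d)) =
        (\<Sum>w | w \<in> P \<and> d \<in> unshuffles w.
          scale (chain_weight q x w * (-1) ^ length (fst d)) (monomial (g d)))"
      by (simp add: sum_scale g_def sum_distrib_left mult.commute)
  qed
  also have "\<dots> = (\<Sum>w\<in>P. \<Sum>d | d \<in> D \<and> d \<in> unshuffles w.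
      scale (chain_weight q x w * (-1) ^ length (fst d)) (monomial (g d)))"
    by (rule sum.swap_restrict) fact+
  also have "\<dots> = (\<Sum>w\<in>P. scale (chain_weight q x w)
      (foldl (\<lambda>z a. lie_bracket z (monomial [a])) (monomial [x]) w))"
  proof (rule sum.cong[OF refl])
    fix w assume "w \<in> P"
    then have "{d. d \<in> D \<and> d \<in> unshuffles w} = unshuffles w" "distinct w"
      using unsh by (auto simp: unshuffles_def P_def permutations_of_set_def)
    then show "(\<Sum>d | d \<in> D \<and> d \<in> unshuffles w.
        scale (chain_weight q x w * (-1) ^ length (fst d)) (monomial (g d))) =
      scale (chain_weight q x w) (foldl (\<lambda>z a. lie_bracket z (monomial [a])) (monomial [x]) w)"
      by (simp add: foldl_lie_bracket scale_sum minus_one_power_times scale_scale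
          times_single_word case_prod_unfold g_def)
  qed
  finally show ?thesis
    by (simp add: P_def)
qed

lemma free_lie_sum: "(\<And>i. i \<in> I \<Longrightarrow> f i \<in> free_lie F X) \<Longrightarrow> (\<Sum>i\<in>I. f i) \<in> free_lie F X"
  by (induction I rule: infinite_finite_induct) (auto intro: free_lie.intros)

lemma free_lie_foldl_lie_bracket:
  "z \<in> free_lie F X \<Longrightarrow> set w \<subseteq> X \<Longrightarrow>
    foldl (\<lambda>z a. lie_bracket z (monomial [a])) z w \<in> free_lie F X"
proof (induction w arbitrary: z)
  case (Cons a w)
  then show ?case
    by (auto intro!: Cons.IH free_lie.bracket free_lie.letter)
qed simp

lemma cyclic_weight_sum_in_free_lie:
  fixes q :: "'a::linorder \<Rightarrow> 'f::field"
  assumes "finite X" "X \<noteq> {}" "prod q X = 1"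
    and "\<And>A. A \<subset> X \<Longrightarrow> A \<noteq> {} \<Longrightarrow> prod q A \<noteq> 1"
    and coeff: "\<And>w. w \<in> permutations_of_set X \<Longrightarrow> cyclic_weight q w \<in> F"
  shows "(\<Sum>w\<in>permutations_of_set X. scale (cyclic_weight q w) (monomial w)) \<in> free_lie F X"
proof -
  obtain x where x: "x \<in> X"
    using \<open>X \<noteq> {}\<close> by blast
  \<comment> \<open>The weight of each bracket is itself the coefficient of the arrangement
    \<open>x # w\<close>.\<close>
  have "chain_weight q x w \<in> F" if "w \<in> permutations_of_set (X - {x})" for w
    using coeff[of "x # w"] that x by (auto simp: cyclic_weight_def permutations_of_set_def)
  then have "(\<Sum>w\<in>permutations_of_set (X - {x}). scale (chain_weight q x w)
      (foldl (\<lambda>z a. lie_bracket z (monomial [a])) (monomial [x]) w)) \<in> free_lie F X"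
    using x by (intro free_lie_sum free_lie.scale free_lie_foldl_lie_bracket free_lie.letter)
      (auto simp: permutations_of_set_def)
  then show ?thesis
    using cyclic_weight_sum_eq_foldl_lie_bracket[OF assms(1) x assms(3,4)] by simp
qed

section \<open>The coefficients lie in K(q)\<close>

lemma poly_vars_diff: "poly_vars (p - q) \<subseteq> poly_vars p \<union> poly_vars q"
  using keys_diff[of p q] by (auto simp: poly_vars_def)

lemma poly_vars_times: "poly_vars (p * q) \<subseteq> poly_vars p \<union> poly_vars q"
proof
  fix i assume "i \<in> poly_vars (p * q)"
  then obtain m where "m \<in> Poly_Mapping.keys (p * q)" "i \<in> Poly_Mapping.keys m"
    by (auto simp: poly_vars_def)
  moreover from this obtain a b where "m = a + b" "a \<in> Poly_Mapping.keys p" "b \<in> Poly_Mapping.keys q"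
    using keys_mult[of p q] by auto
  ultimately show "i \<in> poly_vars p \<union> poly_vars q"
    using Poly_Mapping.keys_add[of a b] by (auto simp: poly_vars_def)
qed

context
  fixes V :: "nat set"
begin

lemma rational_functionsE:
  assumes "r \<in> rational_functions V"
  obtains a b where "r = Fract a b" "b \<noteq> 0" "poly_vars a \<subseteq> V" "poly_vars b \<subseteq> V"
  using assms by (auto simp: rational_functions_def)

lemma rational_functionsI:
  "b \<noteq> 0 \<Longrightarrow> poly_vars a \<subseteq> V \<Longrightarrow> poly_vars b \<subseteq> V \<Longrightarrow> Fract a b \<in> rational_functions V"
  by (auto simp: rational_functions_def)

lemma rational_functions_0: "0 \<in> rational_functions V"
  unfolding Zero_fract_def by (rule rational_functionsI) (auto simp: poly_vars_def)

lemma rational_functions_1: "1 \<in> rational_functions V"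
  unfolding One_fract_def by (rule rational_functionsI) (auto simp: poly_vars_def)

lemma rational_functions_times:
  assumes "r \<in> rational_functions V" "s \<in> rational_functions V"
  shows "r * s \<in> rational_functions V"
proof -
  obtain a b where ab: "r = Fract a b" "b \<noteq> 0" "poly_vars a \<subseteq> V" "poly_vars b \<subseteq> V"
    using assms(1) by (rule rational_functionsE)
  obtain c d where cd: "s = Fract c d" "d \<noteq> 0" "poly_vars c \<subseteq> V" "poly_vars d \<subseteq> V"
    using assms(2) by (rule rational_functionsE)
  show ?thesis
    using ab cd poly_vars_times[of a c] poly_vars_times[of b d] by (auto intro!: rational_functionsI)
qed

lemma rational_functions_diff:
  assumes "r \<in> rational_functions V" "s \<in> rational_functions V"
  shows "r - s \<in> rational_functions V"
proof -
  obtain a b where ab: "r = Fract a b" "b \<noteq> 0" "poly_vars a \<subseteq> V" "poly_vars b \<subseteq> V"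
    using assms(1) by (rule rational_functionsE)
  obtain c d where cd: "s = Fract c d" "d \<noteq> 0" "poly_vars c \<subseteq> V" "poly_vars d \<subseteq> V"
    using assms(2) by (rule rational_functionsE)
  have "poly_vars (a * d - c * b) \<subseteq> V" "poly_vars (b * d) \<subseteq> V"
    using ab(3,4) cd(3,4) poly_vars_times[of a d] poly_vars_times[of c b] poly_vars_times[of b d]
      poly_vars_diff[of "a * d" "c * b"] by blast+
  then show ?thesis
    using ab(1,2) cd(1,2) by (simp add: rational_functionsI)
qed

lemma rational_functions_inverse:
  assumes "r \<in> rational_functions V"
  shows "inverse r \<in> rational_functions V"
proof -
  obtain a b where ab: "r = Fract a b" "b \<noteq> 0" "poly_vars a \<subseteq> V" "poly_vars b \<subseteq> V"
    using assms by (rule rational_functionsE)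
  show ?thesis
  proof (cases "a = 0")
    case True
    then have "r = 0"
      using ab by (simp add: Zero_fract_def eq_fract)
    then show ?thesis
      using rational_functions_0 by simp
  next
    case False
    then show ?thesis
      using ab by (auto intro: rational_functionsI)
  qed
qed

lemma rational_functions_prod:
  "(\<And>i. i \<in> I \<Longrightarrow> f i \<in> rational_functions V) \<Longrightarrow> prod f I \<in> rational_functions V"
  by (induction I rule: infinite_finite_induct) (auto intro: rational_functions_1 rational_functions_times)

lemma indet_in_rational_functions: "i \<in> V \<Longrightarrow> indet i \<in> rational_functions V"
  unfolding indet_def by (rule rational_functionsI) (auto simp: poly_vars_def)

end

lemma qvar_in_Kq:
  assumes "1 \<le> i" "i \<le> n"
  shows "qvar n i \<in> Kq n"
  using assms unfolding qvar_def Kq_def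
  by (auto intro!: rational_functions_inverse rational_functions_prod indet_in_rational_functions)

lemma e_coeff_in_Kq:
  assumes "\<sigma> permutes {1..n}"
  shows "e_coeff n \<sigma> \<in> Kq n"
proof -
  define V where "V = {1..<n}"
  have qvar: "qvar n (\<sigma> k) \<in> (rational_functions V :: 'k::field ratfun set)" if "1 \<le> k" "k \<le> n" for k
    using permutes_in_image[OF assms, of k] that qvar_in_Kq[of "\<sigma> k" n] by (simp add: Kq_def V_def)
  show ?thesis
    unfolding e_coeff_def Kq_def divide_inverse V_def[symmetric]
    by (intro rational_functions_times rational_functions_inverse rational_functions_prod
        rational_functions_diff rational_functions_1 qvar) (auto simp: descents_def)
qed

section \<open>Products of the variables over proper subsets\<close>

lemma prod_indet:
  "(\<Prod>i\<in>A. indet i :: 'k::field ratfun) =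
    Fract (Poly_Mapping.single (\<Sum>i\<in>A. Poly_Mapping.single i 1) 1) 1"
  by (induction A rule: infinite_finite_induct) (auto simp: indet_def One_fract_def mult_single)

text \<open>The product is a single monomial with nonzero exponent vector, unlike the constant
  1.\<close>

lemma prod_indet_neq_1:
  assumes "finite A" "A \<noteq> {}"
  shows "(\<Prod>i\<in>A. indet i) \<noteq> (1 :: 'k::field ratfun)"
proof
  define m where "m = (\<Sum>i\<in>A. Poly_Mapping.single i (1::nat))"
  assume "(\<Prod>i\<in>A. indet i) = (1 :: 'k ratfun)"
  then have "Poly_Mapping.single m (1::'k) = 1"
    unfolding prod_indet One_fract_def by (simp add: eq_fract m_def)
  then have "m = 0"
    by (metis lookup_one lookup_single_eq when_simps(2) zero_neq_one)
  moreover obtain i where "i \<in> A"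
    using assms by blast
  then have "Poly_Mapping.lookup m i = 1"
    using assms by (simp add: m_def lookup_sum lookup_single when_def)
  ultimately show False by simp
qed

text \<open>Without \<open>n\<close> in \<open>A\<close> this is a product of indeterminates.
  Otherwise it is the inverse of the product over the complement, which is nonempty and avoids
  \<open>n\<close>.\<close>

lemma prod_qvar_neq_1:
  assumes "A \<subset> {1..n}" "A \<noteq> {}"
  shows "(\<Prod>i\<in>A. qvar n i) \<noteq> (1 :: 'k::field ratfun)"
proof -
  have *: "(\<Prod>i\<in>B. qvar n i) \<noteq> (1 :: 'k ratfun)" if "B \<subseteq> {1..n}" "n \<notin> B" "B \<noteq> {}" for B
  proof -
    have "(\<Prod>i\<in>B. qvar n i) = (\<Prod>i\<in>B. indet i :: 'k ratfun)"
      using that by (intro prod.cong) (auto simp: qvar_def)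
    then show ?thesis
      using that prod_indet_neq_1[of B] finite_subset by auto
  qed
  show ?thesis
  proof (cases "n \<in> A")
    case True
    have "(\<Prod>i\<in>A. qvar n i) * (\<Prod>i\<in>{1..n} - A. qvar n i) = (1 :: 'k ratfun)"
      using assms prod.subset_diff[of A "{1..n}" "qvar n :: _ \<Rightarrow> 'k ratfun"] prod_qvar[of n, where 'k='k]
      by (auto simp: mult.commute)
    moreover have "(\<Prod>i\<in>{1..n} - A. qvar n i) \<noteq> (1 :: 'k ratfun)"
      using assms True by (intro *) auto
    ultimately show ?thesis by auto
  next
    case False
    then show ?thesis
      using assms by (intro *) auto
  qed
qed

section \<open>Descent formula and cyclic weight\<close>

text \<open>Unrolls the recursion by positions: the step from \<open>j\<close> to
  \<open>Suc j\<close> carries the suffix starting at \<open>Suc j\<close>, the complement of the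
  prefix ending at \<open>j\<close>.\<close>

lemma chain_weight_map:
  assumes "inj_on \<sigma> {i..n}" "i \<le> n"
  shows "chain_weight q (\<sigma> i) (map \<sigma> [Suc i..<Suc n]) =
    (\<Prod>j=i..<n. (if \<sigma> j < \<sigma> (Suc j) then \<Prod>k=Suc j..n. q (\<sigma> k) else 1) / ((\<Prod>k=Suc j..n. q (\<sigma> k)) - 1))"
  using assms(2,1)
proof (induction i rule: inc_induct)
  case base
  then show ?case by simp
next
  case (step i)
  have upt: "[Suc i..<Suc n] = Suc i # [Suc (Suc i)..<Suc n]"
    using step.hyps by (simp add: upt_conv_Cons)
  have "set (map \<sigma> [Suc i..<Suc n]) = \<sigma> ` {Suc i..n}"
    by auto
  then have "prod q (set (map \<sigma> [Suc i..<Suc n])) = (\<Prod>k=Suc i..n. q (\<sigma> k))"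
    using step.prems by (simp add: prod.reindex inj_on_def)
  moreover have "inj_on \<sigma> {Suc i..n}"
    using step.prems by (rule inj_on_subset) auto
  ultimately show ?case
    using step.IH step.hyps unfolding upt by (simp add: prod.atLeast_Suc_lessThan)
qed

text \<open>The total product is 1, so the prefix product \<open>Q j\<close> and the suffix product
  \<open>S j\<close> are mutually inverse, and the two formulas agree factor by factor.\<close>

lemma e_coeff_eq_cyclic_weight:
  assumes \<sigma>: "\<sigma> permutes {1..n}" and "n \<ge> 1"
  shows "e_coeff n \<sigma> = cyclic_weight (qvar n) (map \<sigma> [1..<Suc n])"
proof -
  define Q where "Q j = (\<Prod>k=1..j. qvar n (\<sigma> k) :: 'a ratfun)" for j
  define S where "S j = (\<Prod>k=Suc j..n. qvar n (\<sigma> k) :: 'a ratfun)" for j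
  have inj: "inj_on \<sigma> B" for B
    using permutes_inj_on[OF \<sigma>] .
  have "(\<Prod>k=1..n. qvar n (\<sigma> k)) = (\<Prod>i=1..n. qvar n i :: 'a ratfun)"
    using prod.permute[OF \<sigma>, of "qvar n :: _ \<Rightarrow> 'a ratfun"] by (simp add: o_def)
  then have total: "(\<Prod>k=1..n. qvar n (\<sigma> k)) = (1 :: 'a ratfun)"
    by (simp only: prod_qvar[OF \<open>n \<ge> 1\<close>])
  have QS: "Q j * S j = 1" "Q j \<noteq> 1" if "j \<in> {1..<n}" for j
  proof -
    have "{1..n} = {1..j} \<union> {Suc j..n}" "{1..j} \<inter> {Suc j..n} = {}"
      using that by auto
    then show "Q j * S j = 1"
      using total by (simp add: Q_def S_def prod.union_disjoint)
    have "(\<Prod>k\<in>\<sigma> ` {1..j}. qvar n k) \<noteq> (1 :: 'a ratfun)"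
    proof (rule prod_qvar_neq_1)
      have "\<sigma> ` {1..j} \<subset> \<sigma> ` {1..n}"
        using that inj by (intro image_strict_mono) auto
      then show "\<sigma> ` {1..j} \<subset> {1..n}"
        by (simp only: permutes_image[OF \<sigma>])
    qed (use that in auto)
    then show "Q j \<noteq> 1"
      by (simp add: Q_def prod.reindex[OF inj])
  qed
  have "e_coeff n \<sigma> = (\<Prod>j\<in>descents n \<sigma>. Q j) / (\<Prod>j=1..<n. 1 - Q j)"
    unfolding e_coeff_def Q_def using \<open>n \<ge> 1\<close> by (intro arg_cong2[where f = "(/)"] prod.cong) auto
  \<comment> \<open>Positions that are not descents contribute 1, giving both products the same
    range.\<close>
  also have "(\<Prod>j\<in>descents n \<sigma>. Q j) = (\<Prod>j=1..<n. if \<sigma> (Suc j) < \<sigma> j then Q j else 1)"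
    using \<open>n \<ge> 1\<close> by (intro prod.mono_neutral_cong_left) (auto simp: descents_def)
  also have "\<dots> / (\<Prod>j=1..<n. 1 - Q j) = (\<Prod>j=1..<n. (if \<sigma> (Suc j) < \<sigma> j then Q j else 1) / (1 - Q j))"
    by (simp add: prod_dividef)
  also have "\<dots> = (\<Prod>j=1..<n. (if \<sigma> j < \<sigma> (Suc j) then S j else 1) / (S j - 1))"
  proof (rule prod.cong[OF refl])
    fix j assume j: "j \<in> {1..<n}"
    have nz: "Q j \<noteq> 0" "1 - Q j \<noteq> 0"
      using QS[OF j] by auto
    have S: "S j = 1 / Q j"
      using QS(1)[OF j] nz(1) by (metis nonzero_mult_div_cancel_left)
    have S_minus_1: "S j - 1 = (1 - Q j) / Q j"
      using nz(1) by (simp add: S diff_divide_distrib)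
    have "\<sigma> j \<noteq> \<sigma> (Suc j)"
      using injD[OF permutes_inj[OF \<sigma>], of j "Suc j"] by auto
    then have "\<sigma> (Suc j) < \<sigma> j \<longleftrightarrow> \<not> \<sigma> j < \<sigma> (Suc j)"
      by auto
    then show "(if \<sigma> (Suc j) < \<sigma> j then Q j else 1) / (1 - Q j) =
        (if \<sigma> j < \<sigma> (Suc j) then S j else 1) / (S j - 1)"
      using nz by (simp add: S_minus_1) (simp add: S)
  qed
  also have "\<dots> = chain_weight (qvar n) (\<sigma> 1) (map \<sigma> [Suc 1..<Suc n])"
    unfolding S_def by (rule chain_weight_map[OF inj \<open>n \<ge> 1\<close>, symmetric])
  also have "\<dots> = cyclic_weight (qvar n) (map \<sigma> [1..<Suc n])"
    using \<open>n \<ge> 1\<close> by (simp add: cyclic_weight_def upt_conv_Cons del: upt_Suc)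
  finally show ?thesis .
qed

text \<open>Injective because a permutation of {1..n} is the identity elsewhere; surjective because
  both sets have n! elements.\<close>

lemma bij_betw_permutes_permutations_of_set:
  "bij_betw (\<lambda>\<sigma>. map \<sigma> [1..<Suc n]) {\<sigma>. \<sigma> permutes {1..n}} (permutations_of_set {1..n})"
proof -
  define f where "f \<sigma> = map \<sigma> [1..<Suc n]" for \<sigma> :: "nat \<Rightarrow> nat"
  define P where "P = {\<sigma>. \<sigma> permutes {1..n}}"
  have "inj_on f P"
  proof (rule inj_onI)
    fix \<sigma> \<tau> assume st: "\<sigma> \<in> P" "\<tau> \<in> P" "f \<sigma> = f \<tau>"
    then have "\<sigma> i = \<tau> i" if "i \<in> {1..n}" for i
      using that by (auto simp: f_def simp del: upt_Suc)
    moreover have "\<sigma> i = \<tau> i" if "i \<notin> {1..n}" for i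
      using that st(1,2) permutes_not_in unfolding P_def by (metis mem_Collect_eq)
    ultimately show "\<sigma> = \<tau>" by blast
  qed
  moreover have sub: "f ` P \<subseteq> permutations_of_set {1..n}"
  proof
    fix w assume "w \<in> f ` P"
    then obtain \<sigma> where \<sigma>: "\<sigma> permutes {1..n}" "w = map \<sigma> [1..<Suc n]"
      by (auto simp: f_def P_def)
    then show "w \<in> permutations_of_set {1..n}"
      using permutes_image[OF \<sigma>(1)] permutes_inj_on[OF \<sigma>(1)]
      by (auto simp: permutations_of_set_def distinct_map atLeastLessThanSuc_atLeastAtMost simp del: upt_Suc)
  qed
  moreover have "f ` P = permutations_of_set {1..n}"
  proof (rule card_subset_eq[OF _ sub])
    have "card P = fact n"
      unfolding P_def by (rule card_permutations) auto
    then show "card (f ` P) = card (permutations_of_set {1..n})"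
      using \<open>inj_on f P\<close> by (simp add: card_image)
  qed simp
  ultimately show ?thesis
    unfolding bij_betw_def f_def P_def by blast
qed

theorem theorem1p7:
  fixes n :: nat
  assumes "n \<ge> 1"
  shows "(e_elem n :: nat word \<Rightarrow>\<^sub>0 'k::field_char_0 ratfun) \<in> lie_elements (Kq n) n"
proof -
  note bij = bij_betw_permutes_permutations_of_set[of n]
  let ?q = "qvar n :: nat \<Rightarrow> 'k ratfun"
  have "e_elem n = (\<Sum>\<sigma> | \<sigma> permutes {1..n}. scale (cyclic_weight ?q (map \<sigma> [1..<Suc n])) (monomial (map \<sigma> [1..<Suc n])))"
    unfolding e_elem_def perm_word_def using assms
    by (intro sum.cong refl) (simp add: e_coeff_eq_cyclic_weight del: upt_Suc)
  also have "\<dots> = (\<Sum>w\<in>permutations_of_set {1..n}. scale (cyclic_weight ?q w) (monomial w))"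
    by (rule sum.reindex_bij_betw[OF bij])
  also have "\<dots> \<in> free_lie (Kq n) {1..n}"
  proof (rule cyclic_weight_sum_in_free_lie)
    show "prod ?q {1..n} = 1" using assms by (rule prod_qvar)
    show "prod ?q A \<noteq> 1" if "A \<subset> {1..n}" "A \<noteq> {}" for A using that by (rule prod_qvar_neq_1)
    show "cyclic_weight ?q w \<in> Kq n" if w: "w \<in> permutations_of_set {1..n}" for w
    proof -
      \<comment> \<open>Each arrangement is the word of a permutation, so its weight is some
        \<open>e_coeff n \<sigma>\<close>, known to lie in \<open>Kq n\<close>.\<close>
      obtain \<sigma> where "\<sigma> permutes {1..n}" "w = map \<sigma> [1..<Suc n]"
        using w bij unfolding bij_betw_def by blast
      then show ?thesis
        using assms e_coeff_in_Kq[of \<sigma> n, where 'a='k] by (simp add: e_coeff_eq_cyclic_weight del: upt_Suc)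
    qed
  qed (use assms in auto)
  moreover have "e_elem n \<in> (perm_space (Kq n) n :: (nat word \<Rightarrow>\<^sub>0 'k ratfun) set)"
    unfolding perm_space_def e_elem_def using e_coeff_in_Kq by blast
  ultimately show ?thesis
    by (simp add: lie_elements_def)
qed

end
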